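(* Let $k\ge2$ and let points $M_1,\dots,M_N\in\mathbb R^k$ with masses $m_1,\dots,m_N>0$ be given, not all contained in one hyperplane, with total mass $m$. Use Cartesian coordinates $(x_1,\dots,x_k)$ with origin at the center of masses $C$. Given a real number $\mu$, let the hyperplane $$x_k=\beta_0+\beta_1x_1+\beta_2x_2+\dots+\beta_{k-1}x_{k-1}$$ have directional hyperplanar moment of inertia in the direction $Cx_k$ equal to $\mu$. Then the coefficients $\beta_0$ and $\beta=(\beta_1,\dots,\beta_{k-1})$ satisfy the equation $$\langle K_1\beta,\beta\rangle-2\langle b,\beta\rangle+m\beta_0^2+J_{kk}=\mu .$$ By varying $\mu$, these equations represent a family of homothetic ellipsoids in the space of parameters $\beta_0,\beta_1,\dots,\beta_{k-1}$.
   Context: Write $x^{(i)}_1,\dots,x^{(i)}_k$ for the coordinates of $M_i$ (with origin at the center of masses) and $J_{jl}=\sum_{i=1}^N m_ix_j^{(i)}x_l^{(i)}$ for $1\le j,l\le k$ (the entries of the hyperplanar operator of inertia at $C$). $K_1=(J_{jl})_{1\le j,l\le k-1}$ is the upper left $(k-1)\times(k-1)$ submatrix and $b=(J_{1k},\dots,J_{k-1\,k})^T$. For a hyperplane $\pi$ not parallel to the axis $Cx_k$, the directional hyperplanar moment of inertia in direction $Cx_k$ is $\sum_{i=1}^N m_i\hat D_i^2$, where $\hat D_i$ is the distance between $M_i$ and the intersection of $\pi$ with the line through $M_i$ parallel to the axis $Cx_k$. The family of ellipsoids refers to those values of $\mu$ for which the solution set of the equation contains more than one point. *)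

theory Defs
  imports "HOL-Analysis.Analysis"
begin

text \<open>
  The space \<open>\<real>\<^sup>k\<close> with \<open>k \<ge> 2\<close> is \<^typ>\<open>real ^ ('n option)\<close> with \<open>CARD('n) = k - 1\<close>: the
  index \<^term>\<open>None\<close> is the distinguished last coordinate \<open>x\<^sub>k\<close>, the indices \<^term>\<open>Some j\<close> are
  the remaining \<open>k - 1\<close> coordinates.
\<close>

definition total_mass :: "nat \<Rightarrow> (nat \<Rightarrow> real) \<Rightarrow> real" where
  "total_mass N m = (\<Sum>i=1..N. m i)"

definition center_of_mass :: "nat \<Rightarrow> (nat \<Rightarrow> real) \<Rightarrow> (nat \<Rightarrow> 'a::real_vector) \<Rightarrow> 'a" where
  "center_of_mass N m x = (1 / total_mass N m) *\<^sub>R (\<Sum>i=1..N. m i *\<^sub>R x i)"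

definition is_hyperplane :: "'a::euclidean_space set \<Rightarrow> bool" where
  "is_hyperplane H \<longleftrightarrow> (\<exists>a c. a \<noteq> 0 \<and> H = {x. a \<bullet> x = c})"

text \<open>
  The points \<^term>\<open>x i\<close> are given by their coordinates relative to the center of masses, so that
  \<open>inertia_matrix\<close> is the hyperplanar operator of inertia at that point.
\<close>

definition inertia_matrix ::
  "nat \<Rightarrow> (nat \<Rightarrow> real) \<Rightarrow> (nat \<Rightarrow> real ^ 'k::finite) \<Rightarrow> real ^ 'k ^ 'k" where
  "inertia_matrix N m x = (\<chi> j l. \<Sum>i=1..N. m i * x i $ j * x i $ l)"

definition inertia_K1 ::
  "nat \<Rightarrow> (nat \<Rightarrow> real) \<Rightarrow> (nat \<Rightarrow> real ^ ('n::finite option)) \<Rightarrow> real ^ 'n ^ 'n" where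
  "inertia_K1 N m x = (\<chi> j l. inertia_matrix N m x $ Some j $ Some l)"

definition inertia_b ::
  "nat \<Rightarrow> (nat \<Rightarrow> real) \<Rightarrow> (nat \<Rightarrow> real ^ ('n::finite option)) \<Rightarrow> real ^ 'n" where
  "inertia_b N m x = (\<chi> j. inertia_matrix N m x $ Some j $ None)"

definition graph_hyperplane :: "real \<Rightarrow> real ^ 'n::finite \<Rightarrow> (real ^ ('n option)) set" where
  "graph_hyperplane \<beta>0 \<beta> = {x. x $ None = \<beta>0 + (\<Sum>j\<in>UNIV. \<beta> $ j * x $ Some j)}"

text \<open>
  Meaningful only for a hyperplane \<open>\<pi>\<close> not parallel to the direction \<open>u\<close>: only then is the
  intersection point described by \<open>THE\<close> unique.
\<close>

definition directional_distance :: "'a::euclidean_space \<Rightarrow> 'a set \<Rightarrow> 'a \<Rightarrow> real" where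
  "directional_distance u \<pi> p = dist p (THE q. q \<in> \<pi> \<inter> range (\<lambda>t. p + t *\<^sub>R u))"

definition directional_moment ::
  "nat \<Rightarrow> (nat \<Rightarrow> real) \<Rightarrow> (nat \<Rightarrow> 'a::euclidean_space) \<Rightarrow> 'a \<Rightarrow> 'a set \<Rightarrow> real" where
  "directional_moment N m x u \<pi> = (\<Sum>i=1..N. m i * (directional_distance u \<pi> (x i))\<^sup>2)"

text \<open>
  An ellipsoid is a nondegenerate (hyper)surface: the image of the unit sphere under an
  invertible affine map.
\<close>

definition ellipsoid :: "'a::euclidean_space set \<Rightarrow> bool" where
  "ellipsoid E \<longleftrightarrow> (\<exists>c (f :: 'a \<Rightarrow> 'a). linear f \<and> bij f \<and> E = (\<lambda>y. c + f y) ` sphere 0 1)"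

definition homothety :: "'a::real_vector \<Rightarrow> real \<Rightarrow> 'a \<Rightarrow> 'a" where
  "homothety c r p = c + r *\<^sub>R (p - c)"

definition homothetic :: "'a::real_vector set \<Rightarrow> 'a set \<Rightarrow> bool" where
  "homothetic A B \<longleftrightarrow> (\<exists>c r. r \<noteq> 0 \<and> B = homothety c r ` A)"

text \<open>
  The space of parameters \<open>(\<beta>\<^sub>0, \<beta>)\<close> is \<^typ>\<open>real \<times> (real ^ 'n)\<close>, a Euclidean space of dimension \<open>k\<close>.
\<close>

definition solution_set ::
  "nat \<Rightarrow> (nat \<Rightarrow> real) \<Rightarrow> (nat \<Rightarrow> real ^ ('n::finite option)) \<Rightarrow> real \<Rightarrow> (real \<times> (real ^ 'n)) set" where
  "solution_set N m x \<mu> = {(\<beta>0, \<beta>).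
     (inertia_K1 N m x *v \<beta>) \<bullet> \<beta> - 2 * (inertia_b N m x \<bullet> \<beta>)
       + total_mass N m * \<beta>0\<^sup>2 + inertia_matrix N m x $ None $ None = \<mu>}"

definition nondegenerate_values ::
  "nat \<Rightarrow> (nat \<Rightarrow> real) \<Rightarrow> (nat \<Rightarrow> real ^ ('n::finite option)) \<Rightarrow> real set" where
  "nondegenerate_values N m x =
     {\<mu>. \<exists>p\<in>solution_set N m x \<mu>. \<exists>q\<in>solution_set N m x \<mu>. p \<noteq> q}"

end

theory Submission
  imports Defs
begin

text \<open>
  Write \<open>y\<^sub>i\<close> for the first \<open>k - 1\<close> coordinates of \<open>M\<^sub>i\<close> and \<open>z\<^sub>i\<close> for the last one. The line
  through \<open>M\<^sub>i\<close> parallel to the last axis meets the hyperplane at signed distance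
  \<open>\<beta>\<^sub>0 + \<langle>\<beta>, y\<^sub>i\<rangle> - z\<^sub>i\<close>, so the directional moment is
  \<open>\<Sum>\<^sub>i m\<^sub>i (\<beta>\<^sub>0 + \<langle>\<beta>, y\<^sub>i\<rangle> - z\<^sub>i)\<^sup>2\<close>. Expanding the square produces the stated quadratic
  polynomial plus terms linear in \<open>\<beta>\<^sub>0\<close>, whose coefficient is a first moment of the masses; it
  vanishes because the origin is the center of masses.

  The quadratic part \<open>m\<beta>\<^sub>0\<^sup>2 + \<langle>K\<^sub>1\<beta>, \<beta>\<rangle>\<close> is positive definite: if \<open>\<langle>K\<^sub>1\<beta>, \<beta>\<rangle> =
  \<Sum>\<^sub>i m\<^sub>i \<langle>\<beta>, y\<^sub>i\<rangle>\<^sup>2\<close> vanished for some \<open>\<beta> \<noteq> 0\<close>, all points would lie in the hyperplane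
  orthogonal to \<open>(\<beta>, 0)\<close>. Hence \<open>K\<^sub>1\<close> is invertible, and completing the square around
  \<open>c = (0, K\<^sub>1\<^sup>-\<^sup>1 b)\<close> turns the equation into \<open>B (p - c) (p - c) = r\<close>, where \<open>B\<close> is the
  polar form of the quadratic part and \<open>r\<close> differs from \<open>\<mu>\<close> by a constant. For \<open>r \<le> 0\<close> this has
  at most one solution. For \<open>r > 0\<close> a linear coordinate change that is orthonormal for \<open>B\<close>
  exhibits the level set as an affine image of the sphere (\<open>ellipsoid_level_set\<close>), and two such
  level sets differ by a scaling about the common center \<open>c\<close> (\<open>homothetic_level_sets\<close>).
\<close>

section \<open>Level sets of positive definite forms\<close>

text \<open>
  Gram--Schmidt orthonormalization with respect to \<open>B\<close>. Keeping \<open>\<phi> b\<close> in the span of the vectors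
  treated so far guarantees that the next vector, once made orthogonal, is nonzero.
\<close>

lemma positive_definite_orthonormal_family:
  fixes B :: "'a::real_vector \<Rightarrow> 'a \<Rightarrow> real"
  assumes "bilinear B" and sym: "\<And>x y. B x y = B y x" and pos: "\<And>x. x \<noteq> 0 \<Longrightarrow> B x x > 0"
    and "finite D" "independent D"
  shows "\<exists>\<phi>. (\<forall>b\<in>D. \<phi> b \<in> span D) \<and> (\<forall>b\<in>D. \<forall>b'\<in>D. B (\<phi> b) (\<phi> b') = of_bool (b = b'))"
  using assms(4,5)
proof (induction D rule: finite_induct)
  case empty
  then show ?case by simp
next
  case (insert a D)
  then have a: "a \<notin> span D" and "independent D"
    by (auto simp: independent_insert)
  with insert.IH obtain \<phi> where span: "\<And>b. b \<in> D \<Longrightarrow> \<phi> b \<in> span D"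
    and orth: "\<And>b b'. b \<in> D \<Longrightarrow> b' \<in> D \<Longrightarrow> B (\<phi> b) (\<phi> b') = of_bool (b = b')"
    by blast
  have lin: "linear (\<lambda>v. B v w)" for w
    using \<open>bilinear B\<close> by (simp add: bilinear_def)
  define s where "s = (\<Sum>b\<in>D. B a (\<phi> b) *\<^sub>R \<phi> b)"
  define w where "w = a - s"
  have "s \<in> span D"
    unfolding s_def by (intro span_sum span_scale span)
  then have w_span: "w \<in> span (insert a D)"
    unfolding w_def by (meson span_base span_diff insertI1 span_mono subset_iff subset_insertI)
  have "w \<noteq> 0"
    using a \<open>s \<in> span D\<close> by (auto simp: w_def)
  then have Bw: "B w w > 0" by (rule pos)
  have w_orth: "B w (\<phi> d) = 0" if "d \<in> D" for d
  proof -
    have "B s (\<phi> d) = (\<Sum>b\<in>D. B a (\<phi> b) * B (\<phi> b) (\<phi> d))"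
      unfolding s_def by (simp add: linear_sum[OF lin] linear_scale[OF lin])
    also have "\<dots> = (\<Sum>b\<in>D. if b = d then B a (\<phi> b) else 0)"
      using that by (intro sum.cong) (auto simp: orth)
    also have "\<dots> = B a (\<phi> d)"
      using that \<open>finite D\<close> by simp
    finally show ?thesis
      unfolding w_def using linear_diff[OF lin] by simp
  qed
  define \<psi> where "\<psi> = \<phi>(a := (1 / sqrt (B w w)) *\<^sub>R w)"
  have unit: "B (\<psi> a) (\<psi> a) = 1"
    using Bw \<open>bilinear B\<close> by (simp add: \<psi>_def bilinear_lmul bilinear_rmul field_simps)
  have new: "B (\<psi> a) (\<psi> d) = 0" if "d \<in> D" for d
    using that insert.hyps w_orth[OF that] \<open>bilinear B\<close> by (auto simp: \<psi>_def bilinear_lmul)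
  have "\<psi> b \<in> span (insert a D)" if "b \<in> insert a D" for b
    using that w_span span span_mono[OF subset_insertI]
    by (auto simp: \<psi>_def span_scale)
  moreover have "B (\<psi> b) (\<psi> b') = of_bool (b = b')"
    if "b \<in> insert a D" "b' \<in> insert a D" for b b'
  proof (cases "b = a \<or> b' = a")
    case True
    then show ?thesis
      using that unit new sym[of "\<psi> b" "\<psi> a"] insert.hyps by (cases "b = b'") auto
  next
    case False
    then show ?thesis using that orth by (auto simp: \<psi>_def)
  qed
  ultimately show ?case by blast
qed

text \<open>
  Sending the standard basis to a \<open>B\<close>-orthonormal family turns \<open>B\<close> into the standard inner
  product; the map is an inverse square root of the matrix of \<open>B\<close> up to an orthogonal map.
\<close>

lemma positive_definite_isometry:
  fixes B :: "'a::euclidean_space \<Rightarrow> 'a \<Rightarrow> real"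
  assumes "bilinear B" and sym: "\<And>x y. B x y = B y x" and pos: "\<And>x. x \<noteq> 0 \<Longrightarrow> B x x > 0"
  obtains f :: "'a \<Rightarrow> 'a" where "linear f" "bij f" "\<And>x y. B (f x) (f y) = x \<bullet> y"
proof -
  obtain \<phi> where orth: "\<And>b b' :: 'a. b \<in> Basis \<Longrightarrow> b' \<in> Basis \<Longrightarrow> B (\<phi> b) (\<phi> b') = of_bool (b = b')"
    using positive_definite_orthonormal_family[OF assms finite_Basis independent_Basis] by blast
  define f where "f = (\<lambda>v::'a. \<Sum>b\<in>Basis. (v \<bullet> b) *\<^sub>R \<phi> b)"
  have "linear f"
    unfolding f_def
    by (intro linearI) (simp_all add: inner_add_left scaleR_add_left sum.distrib scaleR_sum_right)
  have iso: "B (f v) (f w) = v \<bullet> w" for v w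
  proof -
    have "B (f v) (f w) = (\<Sum>b\<in>Basis. \<Sum>b'\<in>Basis. (w \<bullet> b') * ((v \<bullet> b) * B (\<phi> b) (\<phi> b')))"
      unfolding f_def
      by (simp add: bilinear_sum[OF \<open>bilinear B\<close>] sum.cartesian_product bilinear_lmul[OF \<open>bilinear B\<close>]
          bilinear_rmul[OF \<open>bilinear B\<close>] case_prod_unfold)
    also have "\<dots> = (\<Sum>b\<in>Basis. \<Sum>b'\<in>Basis. if b' = b then (v \<bullet> b) * (w \<bullet> b') else 0)"
      by (intro sum.cong) (auto simp: orth)
    also have "\<dots> = v \<bullet> w"
      by (simp add: euclidean_inner[of v w])
    finally show ?thesis .
  qed
  have "inj f"
  proof (rule linear_injective_0[OF \<open>linear f\<close>, THEN iffD2], intro allI impI)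
    fix v assume "f v = 0"
    then have "v \<bullet> v = 0"
      using iso[of v v] \<open>bilinear B\<close> by (simp add: bilinear_lzero)
    then show "v = 0" by simp
  qed
  then have "bij f"
    using linear_injective_imp_surjective[OF \<open>linear f\<close>] by (simp add: bij_def)
  from that[OF \<open>linear f\<close> this iso] show thesis .
qed

lemma ellipsoid_level_set:
  fixes B :: "'a::euclidean_space \<Rightarrow> 'a \<Rightarrow> real"
  assumes "bilinear B" and "\<And>x y. B x y = B y x" and "\<And>x. x \<noteq> 0 \<Longrightarrow> B x x > 0" and "r > 0"
  shows "ellipsoid {p. B (p - c) (p - c) = r}"
proof -
  obtain f :: "'a \<Rightarrow> 'a" where f: "linear f" "bij f" and iso: "\<And>x y. B (f x) (f y) = x \<bullet> y"
    using positive_definite_isometry[OF assms(1-3)] by blast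
  define g where "g = (\<lambda>y. f (sqrt r *\<^sub>R y))"
  have "linear g"
    unfolding g_def using linear_compose[OF linear_scale_self f(1)] by (simp add: o_def)
  have "inj g"
    using \<open>r > 0\<close> bij_is_inj[OF f(2)] by (intro injI) (simp add: g_def inj_eq)
  then have "bij g"
    using linear_injective_imp_surjective[OF \<open>linear g\<close>] by (simp add: bij_def)
  have "{p. B (p - c) (p - c) = r} = (\<lambda>y. c + g y) ` sphere 0 1"
  proof -
    have norm_g: "B (g y) (g y) = r * (norm y)\<^sup>2" for y
      using \<open>r > 0\<close> by (simp add: g_def iso power2_norm_eq_inner)
    have "p \<in> (\<lambda>y. c + g y) ` sphere 0 1" if "B (p - c) (p - c) = r" for p
    proof -
      obtain y where y: "p - c = g y"
        using \<open>bij g\<close> by (metis bij_pointE)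
      then have "(norm y)\<^sup>2 = 1"
        using that norm_g[of y] \<open>r > 0\<close> by simp
      then have "norm y = 1"
        by (simp add: power2_eq_1_iff) (smt (verit) norm_ge_zero)
      with y show ?thesis by (auto simp: image_iff algebra_simps intro!: bexI[of _ y])
    qed
    then show ?thesis by (auto simp: norm_g)
  qed
  with \<open>linear g\<close> \<open>bij g\<close> show ?thesis unfolding ellipsoid_def by blast
qed

text \<open>
  Scaling \<open>p - c\<close> by \<open>t\<close> multiplies the form by \<open>t\<^sup>2\<close>, so the ratio has to be \<open>sqrt (s / r)\<close>.
\<close>

lemma homothetic_level_sets:
  fixes B :: "'a::real_vector \<Rightarrow> 'a \<Rightarrow> real"
  assumes "bilinear B" "r > 0" "s > 0"
  shows "homothetic {p. B (p - c) (p - c) = r} {p. B (p - c) (p - c) = s}"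
proof -
  define t where "t = sqrt (s / r)"
  have t: "t > 0" "t * t = s / r"
    using assms by (simp_all add: t_def)
  have scale: "B (a *\<^sub>R v) (a *\<^sub>R v) = a * a * B v v" for a v
    using \<open>bilinear B\<close> by (simp add: bilinear_lmul bilinear_rmul)
  have "{p. B (p - c) (p - c) = s} = homothety c t ` {p. B (p - c) (p - c) = r}"
  proof (intro equalityI subsetI)
    fix q assume q: "q \<in> {p. B (p - c) (p - c) = s}"
    define p where "p = c + (1 / t) *\<^sub>R (q - c)"
    have "q = homothety c t p"
      using t by (simp add: p_def homothety_def)
    moreover have "B (p - c) (p - c) = s / (t * t)"
      using q t scale[of "1 / t" "q - c"] by (simp add: p_def)
    then have "B (p - c) (p - c) = r"
      using t assms by simp
    ultimately show "q \<in> homothety c t ` {p. B (p - c) (p - c) = r}" by blast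
  next
    fix q assume "q \<in> homothety c t ` {p. B (p - c) (p - c) = r}"
    then show "q \<in> {p. B (p - c) (p - c) = s}"
      using t assms by (auto simp: homothety_def scale)
  qed
  with t show ?thesis unfolding homothetic_def by (metis less_irrefl)
qed

lemma level_set_two_points_imp_pos:
  fixes B :: "'a::real_vector \<Rightarrow> 'a \<Rightarrow> real"
  assumes pos: "\<And>x. x \<noteq> 0 \<Longrightarrow> B x x > 0"
    and "B (p - c) (p - c) = r" "B (q - c) (q - c) = r" "p \<noteq> q"
  shows "r > 0"
proof -
  have "p - c \<noteq> 0 \<or> q - c \<noteq> 0" using \<open>p \<noteq> q\<close> by auto
  then show ?thesis using pos[of "p - c"] pos[of "q - c"] assms by auto
qed

section \<open>The directional moment\<close>

definition lateral_part :: "real ^ ('n::finite option) \<Rightarrow> real ^ 'n" where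
  "lateral_part p = (\<chi> j. p $ Some j)"

lemma directional_distance_graph_hyperplane:
  fixes p :: "real ^ ('n::finite option)"
  shows "directional_distance (axis None 1) (graph_hyperplane \<beta>0 \<beta>) p
         = \<bar>\<beta>0 + \<beta> \<bullet> lateral_part p - p $ None\<bar>"
proof -
  define u :: "real ^ ('n option)" where "u = axis None 1"
  define t where "t = \<beta>0 + \<beta> \<bullet> lateral_part p - p $ None"
  have u: "u $ None = 1" "\<And>j. u $ Some j = 0"
    by (simp_all add: u_def axis_def)
  have on_line: "p + s *\<^sub>R u \<in> graph_hyperplane \<beta>0 \<beta> \<longleftrightarrow> s = t" for s
    by (auto simp: graph_hyperplane_def u t_def lateral_part_def inner_vec_def)
  have "(THE q. q \<in> graph_hyperplane \<beta>0 \<beta> \<inter> range (\<lambda>t. p + t *\<^sub>R u)) = p + t *\<^sub>R u"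
    using on_line by (intro the_equality) auto
  then have "directional_distance u (graph_hyperplane \<beta>0 \<beta>) p = dist p (p + t *\<^sub>R u)"
    by (simp add: directional_distance_def)
  also have "\<dots> = \<bar>t\<bar>"
    by (simp add: dist_norm u_def)
  finally show ?thesis by (simp add: u_def t_def)
qed

text \<open>
  Writing the form of \<open>K\<^sub>1\<close> as a mass-weighted sum of products makes both its symmetry and its
  positivity visible.
\<close>

lemma inertia_K1_inner:
  "(inertia_K1 N m x *v \<beta>) \<bullet> \<gamma>
   = (\<Sum>i=1..N. m i * (\<beta> \<bullet> lateral_part (x i)) * (\<gamma> \<bullet> lateral_part (x i)))"
proof -
  have "(inertia_K1 N m x *v \<beta>) \<bullet> \<gamma>
      = (\<Sum>j\<in>UNIV. \<Sum>l\<in>UNIV. \<Sum>i=1..N. m i * x i $ Some j * x i $ Some l * \<beta> $ l * \<gamma> $ j)"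
    by (simp add: inner_vec_def matrix_vector_mult_def inertia_K1_def inertia_matrix_def
        sum_distrib_right)
  also have "\<dots> = (\<Sum>j\<in>UNIV. \<Sum>i=1..N. \<Sum>l\<in>UNIV. m i * x i $ Some j * x i $ Some l * \<beta> $ l * \<gamma> $ j)"
    by (intro sum.cong refl sum.swap)
  also have "\<dots> = (\<Sum>i=1..N. \<Sum>j\<in>UNIV. \<Sum>l\<in>UNIV. m i * x i $ Some j * x i $ Some l * \<beta> $ l * \<gamma> $ j)"
    by (rule sum.swap)
  also have "\<dots> = (\<Sum>i=1..N. \<Sum>l\<in>UNIV. \<Sum>j\<in>UNIV. m i * x i $ Some j * x i $ Some l * \<beta> $ l * \<gamma> $ j)"
    by (rule sum.cong, rule refl, rule sum.swap)
  also have "\<dots> = (\<Sum>i=1..N. m i * (\<beta> \<bullet> lateral_part (x i)) * (\<gamma> \<bullet> lateral_part (x i)))"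
    by (simp add: inner_vec_def lateral_part_def sum_distrib_left sum_distrib_right mult_ac)
  finally show ?thesis .
qed

lemma inertia_b_inner:
  "inertia_b N m x \<bullet> \<beta> = (\<Sum>i=1..N. m i * x i $ None * (\<beta> \<bullet> lateral_part (x i)))"
proof -
  have "inertia_b N m x \<bullet> \<beta> = (\<Sum>j\<in>UNIV. \<Sum>i=1..N. m i * x i $ Some j * x i $ None * \<beta> $ j)"
    by (simp add: inner_vec_def inertia_b_def inertia_matrix_def sum_distrib_right)
  also have "\<dots> = (\<Sum>i=1..N. \<Sum>j\<in>UNIV. m i * x i $ Some j * x i $ None * \<beta> $ j)"
    by (rule sum.swap)
  also have "\<dots> = (\<Sum>i=1..N. m i * x i $ None * (\<beta> \<bullet> lateral_part (x i)))"
    by (simp add: inner_vec_def lateral_part_def sum_distrib_left mult_ac)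
  finally show ?thesis .
qed

lemma directional_moment_graph_hyperplane:
  fixes x :: "nat \<Rightarrow> real ^ ('n::finite option)"
  assumes first_moment: "(\<Sum>i=1..N. m i *\<^sub>R x i) = 0"
  shows "directional_moment N m x (axis None 1) (graph_hyperplane \<beta>0 \<beta>)
         = (inertia_K1 N m x *v \<beta>) \<bullet> \<beta> - 2 * (inertia_b N m x \<bullet> \<beta>)
           + total_mass N m * \<beta>0\<^sup>2 + inertia_matrix N m x $ None $ None"
proof -
  define h where "h = (\<lambda>i. \<beta> \<bullet> lateral_part (x i))"
  define z where "z = (\<lambda>i. x i $ None)"
  have component: "(\<Sum>i=1..N. m i * x i $ j) = 0" for j
    using arg_cong[OF first_moment, of "\<lambda>v. v $ j"] by simp
  then have mz: "(\<Sum>i=1..N. m i * z i) = 0"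
    by (simp add: z_def)
  have "(\<Sum>i=1..N. m i * h i) = (\<Sum>i=1..N. \<Sum>j\<in>UNIV. \<beta> $ j * (m i * x i $ Some j))"
    by (simp add: h_def inner_vec_def lateral_part_def sum_distrib_left mult_ac)
  also have "\<dots> = (\<Sum>j\<in>UNIV. \<beta> $ j * (\<Sum>i=1..N. m i * x i $ Some j))"
    unfolding sum_distrib_left by (rule sum.swap)
  finally have mh: "(\<Sum>i=1..N. m i * h i) = 0"
    by (simp only: component) simp
  have "directional_moment N m x (axis None 1) (graph_hyperplane \<beta>0 \<beta>)
      = (\<Sum>i=1..N. m i * (\<beta>0 + h i - z i)\<^sup>2)"
    by (simp add: directional_moment_def directional_distance_graph_hyperplane h_def z_def)
  also have "\<dots> = (\<Sum>i=1..N. m i * h i * h i - 2 * (m i * z i * h i) + m i * \<beta>0\<^sup>2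
      + m i * z i * z i + 2 * \<beta>0 * (m i * h i) - 2 * \<beta>0 * (m i * z i))"
    by (intro sum.cong) (auto simp: power2_eq_square algebra_simps)
  also have "\<dots> = (\<Sum>i=1..N. m i * h i * h i) - 2 * (\<Sum>i=1..N. m i * z i * h i)
      + (\<Sum>i=1..N. m i) * \<beta>0\<^sup>2 + (\<Sum>i=1..N. m i * z i * z i)
      + 2 * \<beta>0 * (\<Sum>i=1..N. m i * h i) - 2 * \<beta>0 * (\<Sum>i=1..N. m i * z i)"
    by (simp only: sum.distrib sum_subtractf sum_distrib_left sum_distrib_right)
  also have "\<dots> = (inertia_K1 N m x *v \<beta>) \<bullet> \<beta> - 2 * (inertia_b N m x \<bullet> \<beta>)
      + total_mass N m * \<beta>0\<^sup>2 + inertia_matrix N m x $ None $ None"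
    unfolding mh mz
    by (simp add: inertia_K1_inner inertia_b_inner total_mass_def inertia_matrix_def h_def z_def)
  finally show ?thesis .
qed

section \<open>The quadratic form on the parameter space\<close>

lemma inertia_K1_symmetric:
  "(inertia_K1 N m x *v \<beta>) \<bullet> \<gamma> = (inertia_K1 N m x *v \<gamma>) \<bullet> \<beta>"
  by (simp add: inertia_K1_inner mult_ac)

text \<open>
  A null vector \<open>\<beta>\<close> of the form is orthogonal to every \<open>y\<^sub>i\<close>, so the points lie in the
  hyperplane with normal vector \<open>(\<beta>, 0)\<close>.
\<close>

lemma inertia_K1_positive_definite:
  fixes x :: "nat \<Rightarrow> real ^ ('n::finite option)"
  assumes masses: "\<forall>i\<in>{1..N}. m i > 0"
    and noncoplanar: "\<not> (\<exists>H. is_hyperplane H \<and> x ` {1..N} \<subseteq> H)"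
    and "\<beta> \<noteq> 0"
  shows "(inertia_K1 N m x *v \<beta>) \<bullet> \<beta> > 0"
proof (rule ccontr)
  assume not_pos: "\<not> (inertia_K1 N m x *v \<beta>) \<bullet> \<beta> > 0"
  define h where "h = (\<lambda>i. \<beta> \<bullet> lateral_part (x i))"
  have nonneg: "m i * h i * h i \<ge> 0" if "i \<in> {1..N}" for i
    using bspec[OF masses that] by (simp add: mult.assoc)
  have "(\<Sum>i=1..N. m i * h i * h i) = 0"
    using not_pos sum_nonneg[of "{1..N}" "\<lambda>i. m i * h i * h i", OF nonneg]
    by (simp add: inertia_K1_inner h_def)
  then have "\<forall>i\<in>{1..N}. m i * h i * h i = 0"
    using nonneg by (subst (asm) sum_nonneg_eq_0_iff) auto
  then have h0: "h i = 0" if "i \<in> {1..N}" for i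
    using masses that by fastforce
  define a :: "real ^ ('n option)" where "a = (\<chi> j. case j of None \<Rightarrow> 0 | Some l \<Rightarrow> \<beta> $ l)"
  have "a \<noteq> 0"
    using \<open>\<beta> \<noteq> 0\<close> by (auto simp: a_def vec_eq_iff split: option.splits)
  moreover have "a \<bullet> x i = h i" for i
    by (simp add: a_def h_def lateral_part_def inner_vec_def UNIV_option_conv sum.reindex)
  ultimately have "is_hyperplane {v. a \<bullet> v = 0} \<and> x ` {1..N} \<subseteq> {v. a \<bullet> v = 0}"
    using h0 by (auto simp: is_hyperplane_def)
  with noncoplanar show False by blast
qed

lemma total_mass_pos:
  fixes x :: "nat \<Rightarrow> real ^ ('n::finite option)"
  assumes masses: "\<forall>i\<in>{1..N}. m i > 0"
    and noncoplanar: "\<not> (\<exists>H. is_hyperplane H \<and> x ` {1..N} \<subseteq> H)"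
  shows "total_mass N m > 0"
proof -
  have "is_hyperplane {v. (axis None 1 :: real ^ ('n option)) \<bullet> v = 0}"
    unfolding is_hyperplane_def by (metis axis_eq_0_iff zero_neq_one)
  \<comment> \<open>The empty configuration is contained in every hyperplane.\<close>
  with noncoplanar have "{1..N} \<noteq> {}" by (metis empty_subsetI image_empty)
  then show ?thesis
    unfolding total_mass_def using masses by (intro sum_pos) auto
qed

definition parameter_form ::
  "nat \<Rightarrow> (nat \<Rightarrow> real) \<Rightarrow> (nat \<Rightarrow> real ^ ('n::finite option))
   \<Rightarrow> real \<times> (real ^ 'n) \<Rightarrow> real \<times> (real ^ 'n) \<Rightarrow> real" where
  "parameter_form N m x p q
   = total_mass N m * fst p * fst q + (inertia_K1 N m x *v snd p) \<bullet> snd q"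

lemma bilinear_parameter_form: "bilinear (parameter_form N m x)"
  unfolding bilinear_def parameter_form_def
  by (auto intro!: linearI simp: algebra_simps matrix_vector_right_distrib inner_add_left
      inner_add_right matrix_vector_mult_scaleR)

lemma parameter_form_symmetric: "parameter_form N m x p q = parameter_form N m x q p"
  by (simp add: parameter_form_def inertia_K1_symmetric[of _ _ _ "snd p" "snd q"])

lemma parameter_form_positive_definite:
  fixes x :: "nat \<Rightarrow> real ^ ('n::finite option)"
  assumes masses: "\<forall>i\<in>{1..N}. m i > 0"
    and noncoplanar: "\<not> (\<exists>H. is_hyperplane H \<and> x ` {1..N} \<subseteq> H)"
    and "p \<noteq> 0"
  shows "parameter_form N m x p p > 0"
proof (cases "snd p = 0")
  case True
  then have "fst p * fst p > 0"
    using \<open>p \<noteq> 0\<close> by (metis not_real_square_gt_zero prod_eq_iff fst_zero snd_zero)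
  with True total_mass_pos[OF masses noncoplanar] show ?thesis
    by (simp add: parameter_form_def mult.assoc)
next
  case False
  have "total_mass N m * (fst p * fst p) \<ge> 0"
    using total_mass_pos[OF masses noncoplanar] by simp
  with inertia_K1_positive_definite[OF masses noncoplanar False] show ?thesis
    by (simp add: parameter_form_def mult.assoc)
qed

text \<open>
  Completing the square: the center has to be \<open>(0, \<gamma>)\<close> with \<open>K\<^sub>1\<gamma> = b\<close> for the linear term
  \<open>- 2\<langle>b, \<beta>\<rangle>\<close> to be absorbed. Neither the center nor the shift depends on \<open>\<mu>\<close>, which is what
  makes the ellipsoids for different \<open>\<mu>\<close> concentric.
\<close>

lemma solution_set_as_level_set:
  fixes x :: "nat \<Rightarrow> real ^ ('n::finite option)"
  assumes masses: "\<forall>i\<in>{1..N}. m i > 0"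
    and noncoplanar: "\<not> (\<exists>H. is_hyperplane H \<and> x ` {1..N} \<subseteq> H)"
  obtains c e where
    "\<And>\<mu>. solution_set N m x \<mu> = {p. parameter_form N m x (p - c) (p - c) = \<mu> + e}"
proof -
  let ?K = "inertia_K1 N m x" and ?b = "inertia_b N m x"
  have "inj ((*v) ?K)"
    unfolding linear_injective_0[OF matrix_vector_mul_linear]
    using inertia_K1_positive_definite[OF masses noncoplanar] by (metis inner_zero_left less_irrefl)
  then have "surj ((*v) ?K)"
    by (intro linear_injective_imp_surjective) auto
  then obtain \<gamma> where \<gamma>: "?K *v \<gamma> = ?b" by (metis surjD)
  define e where "e = ?b \<bullet> \<gamma> - inertia_matrix N m x $ None $ None"
  have "parameter_form N m x ((\<beta>0, \<beta>) - (0, \<gamma>)) ((\<beta>0, \<beta>) - (0, \<gamma>))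
      = (?K *v \<beta>) \<bullet> \<beta> - 2 * (?b \<bullet> \<beta>) + total_mass N m * \<beta>0\<^sup>2 + ?b \<bullet> \<gamma>" for \<beta>0 \<beta>
    using inertia_K1_symmetric[of N m x \<beta> \<gamma>]
    by (simp add: parameter_form_def matrix_vector_mult_diff_distrib inner_diff_left
        inner_diff_right \<gamma> power2_eq_square algebra_simps)
  then have "solution_set N m x \<mu> = {p. parameter_form N m x (p - (0, \<gamma>)) (p - (0, \<gamma>)) = \<mu> + e}" for \<mu>
    by (auto simp: solution_set_def e_def)
  then show thesis by (rule that)
qed

section \<open>The family of ellipsoids\<close>

theorem proposition5p3:
  fixes N :: nat and m :: "nat \<Rightarrow> real" and x :: "nat \<Rightarrow> real ^ ('n::finite option)"
  assumes masses: "\<And>i. i \<in> {1..N} \<Longrightarrow> m i > 0"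
    and noncoplanar: "\<not> (\<exists>H. is_hyperplane H \<and> x ` {1..N} \<subseteq> H)"
    and origin: "center_of_mass N m x = 0"
  shows "(\<forall>\<mu> \<beta>0 \<beta>.
            directional_moment N m x (axis None 1) (graph_hyperplane \<beta>0 \<beta>) = \<mu> \<longrightarrow>
              (inertia_K1 N m x *v \<beta>) \<bullet> \<beta> - 2 * (inertia_b N m x \<bullet> \<beta>)
                + total_mass N m * \<beta>0\<^sup>2 + inertia_matrix N m x $ None $ None = \<mu>)
       \<and> (\<forall>\<mu>\<in>nondegenerate_values N m x. ellipsoid (solution_set N m x \<mu>))
       \<and> (\<forall>\<mu>\<in>nondegenerate_values N m x. \<forall>\<nu>\<in>nondegenerate_values N m x.
            homothetic (solution_set N m x \<mu>) (solution_set N m x \<nu>))"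
proof -
  let ?B = "parameter_form N m x"
  have masses': "\<forall>i\<in>{1..N}. m i > 0"
    using masses by blast
  have "(\<Sum>i=1..N. m i *\<^sub>R x i) = 0"
    using origin total_mass_pos[OF masses' noncoplanar] by (simp add: center_of_mass_def)
  note moment = directional_moment_graph_hyperplane[OF this]
  note pos = parameter_form_positive_definite[OF masses' noncoplanar]
  obtain c e where level: "\<And>\<mu>. solution_set N m x \<mu> = {p. ?B (p - c) (p - c) = \<mu> + e}"
    using solution_set_as_level_set[OF masses' noncoplanar] by blast
  have r_pos: "\<mu> + e > 0" if "\<mu> \<in> nondegenerate_values N m x" for \<mu>
  proof -
    from that obtain p q where "?B (p - c) (p - c) = \<mu> + e" "?B (q - c) (q - c) = \<mu> + e" "p \<noteq> q"
      unfolding nondegenerate_values_def level by blast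
    then show ?thesis using level_set_two_points_imp_pos[of ?B p c "\<mu> + e" q] pos by auto
  qed
  have "ellipsoid (solution_set N m x \<mu>)" if "\<mu> \<in> nondegenerate_values N m x" for \<mu>
    unfolding level
    using ellipsoid_level_set[OF bilinear_parameter_form parameter_form_symmetric pos r_pos[OF that]] .
  moreover have "homothetic (solution_set N m x \<mu>) (solution_set N m x \<nu>)"
    if "\<mu> \<in> nondegenerate_values N m x" "\<nu> \<in> nondegenerate_values N m x" for \<mu> \<nu>
    unfolding level using homothetic_level_sets[OF bilinear_parameter_form] that r_pos by blast
  ultimately show ?thesis using moment by simp
qed

end
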